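(* There exists an absolute constant $A<\infty$ such that for every weight $w$ on $\mathbb{R}$ in the dyadic class $A_2$, the operator $S_{w^{-1}}$ is of restricted weak type from $L^2(w^{-1})$ to $L^{2,\infty}(w)$ with constant at most $A\,[w]_{A_2}^{1/2}$; that is, for every measurable set $E\subset\mathbb{R}$ with $w^{-1}(E)<\infty$ and every $\lambda>0$, $$\lambda\,\big(w\{x:\ S(w^{-1}\mathbf 1_E)(x)>\lambda\}\big)^{1/2}\le A\,[w]_{A_2}^{1/2}\,\big(w^{-1}(E)\big)^{1/2}.$$
   Context: $\mathcal{D}$ is the family of standard dyadic intervals of $\mathbb{R}$. For $J\in\mathcal{D}$, $J_+$ and $J_-$ are its two dyadic children (halves), and $\langle f\rangle_J=\frac1{|J|}\int_J f\,dx$. The martingale difference is $\Delta_J f=\frac12\big[(\langle f\rangle_{J_+}-\langle f\rangle_{J_-})\mathbf 1_{J_+}+(\langle f\rangle_{J_-}-\langle f\rangle_{J_+})\mathbf 1_{J_-}\big]$. The dyadic square function is $Sf(x)=\big(\sum_{J\in\mathcal{D}}|\Delta_Jf(x)|^2\mathbf 1_J(x)\big)^{1/2}$, and $S_{w^{-1}}\varphi=S(\varphi w^{-1})$. A weight is a positive locally integrable function $w$ with $w^{-1}$ locally integrable; it is in the dyadic class $A_2$ if $[w]_{A_2}=\sup_{J\in\mathcal{D}}\langle w\rangle_J\langle w^{-1}\rangle_J<\infty$. For a measurable set $E$, $w(E)=\int_Ew\,dx$ and $w^{-1}(E)=\int_Ew^{-1}\,dx$. Restricted weak type means the weak-type inequality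 tested on characteristic functions $\varphi=\mathbf 1_E$ of measurable sets. *)

theory Defs
  imports "HOL-Analysis.Analysis"
begin

definition dyadic_interval :: "int \<Rightarrow> int \<Rightarrow> real set" where
  "dyadic_interval n k = {of_int k * 2 powi n ..< (of_int k + 1) * 2 powi n}"

definition dyadic_intervals :: "real set set" where
  "dyadic_intervals = {dyadic_interval n k | n k. True}"

text \<open>The halves are defined for any bounded interval by cutting at its midpoint; the lemmas
  \<open>lower_half_dyadic\<close> and \<open>upper_half_dyadic\<close> below identify them with the dyadic children.\<close>

definition lower_half :: "real set \<Rightarrow> real set" where
  "lower_half J = {x \<in> J. x < (Inf J + Sup J) / 2}"

definition upper_half :: "real set \<Rightarrow> real set" where
  "upper_half J = {x \<in> J. (Inf J + Sup J) / 2 \<le> x}"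

definition average :: "(real \<Rightarrow> real) \<Rightarrow> real set \<Rightarrow> real" where
  "average f J = (LINT x:J|lebesgue. f x) / measure lebesgue J"

definition mart_diff :: "real set \<Rightarrow> (real \<Rightarrow> real) \<Rightarrow> real \<Rightarrow> real" where
  "mart_diff J f x =
     ((average f (upper_half J) - average f (lower_half J)) * indicator (upper_half J) x
    + (average f (lower_half J) - average f (upper_half J)) * indicator (lower_half J) x) / 2"

text \<open>Square root on \<open>[0, \<infinity>]\<close>; the square function and the measures of sets take values there,
  so that divergent sums and infinite measures are not silently collapsed to \<open>0\<close>.\<close>

definition ennsqrt :: "ennreal \<Rightarrow> ennreal" where
  "ennsqrt a = (if a = \<infinity> then \<infinity> else ennreal (sqrt (enn2real a)))"

definition square_fun :: "(real \<Rightarrow> real) \<Rightarrow> real \<Rightarrow> ennreal" where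
  "square_fun f x =
     ennsqrt (\<Sum>\<^sub>\<infinity>J\<in>dyadic_intervals. ennreal (\<bar>mart_diff J f x\<bar>\<^sup>2 * indicator J x))"

text \<open>\<open>weighted_square_fun v \<phi>\<close> is the operator \<open>S\<^sub>v \<phi> = S (\<phi> v)\<close>, to be used with
  \<open>v = w\<^sup>-\<^sup>1\<close>.\<close>

definition weighted_square_fun :: "(real \<Rightarrow> real) \<Rightarrow> (real \<Rightarrow> real) \<Rightarrow> real \<Rightarrow> ennreal" where
  "weighted_square_fun v \<phi> = square_fun (\<lambda>x. \<phi> x * v x)"

definition locally_integrable :: "(real \<Rightarrow> real) \<Rightarrow> bool" where
  "locally_integrable f \<longleftrightarrow> (\<forall>K. compact K \<longrightarrow> f absolutely_integrable_on K)"

text \<open>Positivity is required almost everywhere only, so that functions such as \<open>\<bar>x\<bar> powr a\<close> with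
  \<open>-1 < a < 1\<close> are weights.\<close>

definition weight :: "(real \<Rightarrow> real) \<Rightarrow> bool" where
  "weight w \<longleftrightarrow> (AE x in lebesgue. 0 < w x)
     \<and> locally_integrable w \<and> locally_integrable (\<lambda>x. inverse (w x))"

definition A2_const :: "(real \<Rightarrow> real) \<Rightarrow> ennreal" where
  "A2_const w =
     (SUP J\<in>dyadic_intervals. ennreal (average w J * average (\<lambda>x. inverse (w x)) J))"

definition dyadic_A2 :: "(real \<Rightarrow> real) \<Rightarrow> bool" where
  "dyadic_A2 w \<longleftrightarrow> weight w \<and> A2_const w < \<infinity>"

definition weight_measure :: "(real \<Rightarrow> real) \<Rightarrow> real set \<Rightarrow> ennreal" where
  "weight_measure w E = (\<integral>\<^sup>+x\<in>E. ennreal (w x) \<partial>lebesgue)"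

lemma dyadic_interval_midpoint:
  "(Inf (dyadic_interval n k) + Sup (dyadic_interval n k)) / 2 = (of_int k + 1 / 2) * 2 powi n"
proof -
  have "of_int k * 2 powi n < (of_int k + 1) * (2 powi n :: real)"
    by (simp add: algebra_simps)
  then show ?thesis
    by (simp add: dyadic_interval_def algebra_simps)
qed

lemma powi_split: "(2::real) powi n = 2 * 2 powi (n - 1)"
  by (simp add: power_int_diff)

lemma lower_half_dyadic: "lower_half (dyadic_interval n k) = dyadic_interval (n - 1) (2 * k)"
  unfolding lower_half_def dyadic_interval_midpoint
  unfolding dyadic_interval_def powi_split[of n]
  using zero_less_power_int[of "2::real" "n - 1"] by (auto simp: algebra_simps)

lemma upper_half_dyadic: "upper_half (dyadic_interval n k) = dyadic_interval (n - 1) (2 * k + 1)"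
  unfolding upper_half_def dyadic_interval_midpoint
  unfolding dyadic_interval_def powi_split[of n]
  using zero_less_power_int[of "2::real" "n - 1"] by (auto simp: algebra_simps)

end

theory Submission
  imports Defs
begin

text \<open>Put \<open>f = w\<^sup>-\<^sup>1 1\<^sub>E\<close>. Since \<open>\<langle>f\<rangle>\<^sub>J \<le> \<langle>w\<^sup>-\<^sup>1\<rangle>\<^sub>J\<close>, the \<open>A\<^sub>2\<close> condition gives
  \<open>w(J) \<langle>f\<rangle>\<^sub>J \<le> [w] \<bar>J\<bar>\<close>; this is the only property of the weight that is used, and the only
  place where it matters that the test function is an indicator. Running down the dyadic tree, one
  stops when \<open>\<langle>f\<rangle>\<^sub>J > t\<close>, where \<open>w(J) \<le> [w] t\<^sup>-\<^sup>2 \<integral>\<^sub>J f\<close>. On the rest one uses Chebyshev's inequality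
  for the fourth power of the square function: the second power would lose a logarithm, because
  \<open>\<Sum> (\<Delta>\<^sub>J f)\<^sup>2 \<bar>J\<bar> / \<langle>f\<rangle>\<^sub>J\<close> is an entropy, whereas in the fourth power this sum is only needed
  below an interval \<open>I\<close>, where it is at most a multiple of \<open>\<bar>I\<bar>\<close> once \<open>t = 1\<close>, and it is then
  multiplied by \<open>(\<Delta>\<^sub>I f)\<^sup>2\<close>, whose sum is controlled by \<open>\<integral> f\<close> because the averages are bounded.
  The two summations are carried out together by one Bellman function.\<close>

section \<open>The Bellman function and its one-step inequality\<close>

text \<open>Here \<open>y\<close> is the current average and \<open>s\<close> the square sum accumulated so far. The concavity of
  \<open>sqrt y\<close> pays for the part \<open>2 s \<delta>\<close> of an increment \<open>(s + \<delta>)\<^sup>2 - s\<^sup>2\<close>, and that of \<open>- y\<^sup>2\<close> for the rest;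
  the coefficient 35 makes \<open>bellman y s \<ge> y\<close> up to \<open>y = 2\<close>, the largest average that a child of an
  interval with average at most 1 can have.\<close>

definition bellman :: "real \<Rightarrow> real \<Rightarrow> real" where
  "bellman y s = 16 * s * sqrt y + 35 * y - 17 * y\<^sup>2"

text \<open>Keeps the Bellman bound nonnegative, and makes it at least 1 where the average exceeds
  1, which is what the stopping case requires.\<close>

lemma bellman_ge:
  assumes "0 \<le> y" "y \<le> 2" "0 \<le> s"
  shows "y \<le> bellman y s"
proof -
  have "y * y \<le> 2 * y"
    using assms by (intro mult_right_mono)
  moreover have "0 \<le> s * sqrt y"
    using assms by simp
  ultimately show ?thesis
    by (simp add: bellman_def power2_eq_square)
qed

text \<open>With \<open>h\<close> and \<open>e\<close> the half sum and half difference of the two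
  roots, \<open>m = h^2 + e^2\<close>. The gap is therefore \<open>e^2 / (sqrt m + h)\<close>, at
  least \<open>e^2 / 2\<close> because \<open>h \<le> sqrt m \<le> 1\<close>, while
  \<open>((b - a) / 2)^2 = 4 * h^2 * e^2\<close> is at most \<open>4 * m * e^2\<close>.\<close>

lemma sqrt_concavity_gap:
  fixes a b :: real
  assumes "0 \<le> a" "0 \<le> b" and m: "m = (a + b) / 2" "0 < m" "m \<le> 1"
  shows "((b - a) / 2)\<^sup>2 / (8 * m) \<le> sqrt m - (sqrt a + sqrt b) / 2"
proof -
  define h where "h = (sqrt a + sqrt b) / 2"
  define e where "e = (sqrt b - sqrt a) / 2"
  define r where "r = sqrt m"
  have ab: "sqrt a = h - e" "sqrt b = h + e"
    by (auto simp: h_def e_def field_simps)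
  have a: "a = (h - e)\<^sup>2" and b: "b = (h + e)\<^sup>2"
    using assms ab by (metis real_sqrt_pow2)+
  have me: "m = h\<^sup>2 + e\<^sup>2"
    by (simp add: m a b power2_eq_square field_simps)
  have h0: "0 \<le> h"
    using assms by (simp add: h_def)
  have r: "r\<^sup>2 = m" "0 < r" "r \<le> 1"
    using assms by (auto simp: r_def)
  have "h\<^sup>2 \<le> r\<^sup>2"
    unfolding r me by simp
  then have hr: "h \<le> r"
    by (rule power2_le_imp_le) (use r(2) in simp)
  have "b - a = 4 * (h * e)"
    unfolding a b by (simp add: power2_eq_square algebra_simps)
  then have d: "((b - a) / 2)\<^sup>2 = 4 * h\<^sup>2 * e\<^sup>2"
    by (simp add: power_mult_distrib)
  have "4 * h\<^sup>2 * e\<^sup>2 \<le> 4 * m * e\<^sup>2"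
    using me by (intro mult_right_mono) auto
  then have "((b - a) / 2)\<^sup>2 / (8 * m) \<le> e\<^sup>2 / 2"
    unfolding d using m(2) by (simp add: pos_divide_le_eq mult_ac)
  also have "e\<^sup>2 / 2 \<le> r - h"
  proof -
    have "(r - h) * (r + h) = e\<^sup>2"
      using r me by (simp add: power2_eq_square algebra_simps)
    moreover have "(r - h) * (r + h) \<le> (r - h) * 2"
      using hr r h0 by (intro mult_left_mono) auto
    ultimately show ?thesis
      by simp
  qed
  finally show ?thesis
    by (simp add: h_def r_def)
qed

text \<open>The extra term is the growth of \<open>s^2\<close> divided by the mean; the bound on
  mass times average will bring in exactly this quotient. The balance explains the coefficients: 16
  turns the gap \<open>\<delta> / (8 * m)\<close> into \<open>2 * s * \<delta> / m\<close>; raising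
  \<open>s\<close> by \<open>\<delta>\<close> costs at most \<open>16 * \<delta>\<close>, and
  \<open>\<delta>^2 / m\<close> at most \<open>\<delta>\<close>; the drop
  \<open>17 * \<delta>\<close> of the quadratic term pays for both.\<close>

lemma bellman_step:
  fixes a b :: real
  assumes "0 \<le> a" "0 \<le> b" "0 \<le> s" and m: "m = (a + b) / 2" "0 < m" "m \<le> 1"
    and \<delta>: "\<delta> = ((b - a) / 2)\<^sup>2"
  shows "(bellman a (s + \<delta>) + bellman b (s + \<delta>)) / 2 + (2 * s * \<delta> + \<delta>\<^sup>2) / m \<le> bellman m s"
proof -
  define A where "A = (sqrt a + sqrt b) / 2"
  have gap: "\<delta> / (8 * m) \<le> sqrt m - A"
    unfolding \<delta> A_def using assms by (intro sqrt_concavity_gap)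
  have \<delta>0: "0 \<le> \<delta>"
    by (simp add: \<delta>)
  \<comment> \<open>Nonnegativity of \<open>a\<close> and \<open>b\<close> enters here: it bounds
    the increment by the squared mean.\<close>
  have "\<delta> = m\<^sup>2 - a * b"
    by (simp add: \<delta> m power2_eq_square field_simps)
  moreover have "0 \<le> a * b"
    using assms by simp
  ultimately have \<delta>m: "\<delta> \<le> m * m"
    by (simp add: power2_eq_square)
  have "\<delta>\<^sup>2 / m \<le> \<delta> * (m * m) / m"
    unfolding power2_eq_square using m \<delta>0 \<delta>m by (intro divide_right_mono mult_left_mono) auto
  also have "\<dots> \<le> \<delta> * 1"
    using m \<delta>0 by (simp add: mult_left_le)
  finally have 1: "\<delta>\<^sup>2 / m \<le> \<delta>"
    by simp
  have "A \<le> sqrt m"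
    using gap divide_nonneg_pos[of \<delta> "8 * m"] \<delta>0 m(2) by linarith
  also have "\<dots> \<le> 1"
    using m by simp
  finally have 2: "\<delta> * A \<le> \<delta>"
    using \<delta>0 by (simp add: mult_left_le)
  have "16 * s * (\<delta> / (8 * m)) \<le> 16 * s * (sqrt m - A)"
    using gap \<open>0 \<le> s\<close> by (intro mult_left_mono) auto
  then have 3: "2 * s * \<delta> / m \<le> 16 * s * sqrt m - 16 * s * A"
    by (simp add: algebra_simps)
  have "a\<^sup>2 + b\<^sup>2 = 2 * m\<^sup>2 + 2 * \<delta>"
    by (simp add: m(1) \<delta> power2_eq_square field_simps)
  moreover have "a + b = 2 * m" "sqrt a + sqrt b = 2 * A"
    by (simp_all add: m(1) A_def)
  moreover have "bellman a (s + \<delta>) + bellman b (s + \<delta>)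
      = 16 * (s + \<delta>) * (sqrt a + sqrt b) + 35 * (a + b) - 17 * (a\<^sup>2 + b\<^sup>2)"
    by (simp add: bellman_def distrib_left)
  ultimately have "bellman a (s + \<delta>) + bellman b (s + \<delta>)
      = 2 * (16 * s * A + 16 * (\<delta> * A) + (35 * m - 17 * m\<^sup>2) - 17 * \<delta>)"
    by (simp add: algebra_simps)
  then have "(bellman a (s + \<delta>) + bellman b (s + \<delta>)) / 2
      = 16 * s * A + 16 * (\<delta> * A) + (35 * m - 17 * m\<^sup>2) - 17 * \<delta>"
    by simp
  moreover have "bellman m s = 16 * s * sqrt m + (35 * m - 17 * m\<^sup>2)"
    by (simp add: bellman_def)
  moreover have "(2 * s * \<delta> + \<delta>\<^sup>2) / m = 2 * s * \<delta> / m + \<delta>\<^sup>2 / m"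
    by (rule add_divide_distrib)
  ultimately show ?thesis
    using 1 2 3 by linarith
qed

section \<open>Dyadic intervals and averages over them\<close>

text \<open>The floor addresses the one interval of level \<open>n\<close> containing
  \<open>x\<close>, so disjointness and covering within a level become immediate.\<close>

lemma mem_dyadic_interval_iff: "x \<in> dyadic_interval n k \<longleftrightarrow> \<lfloor>x / 2 powi n\<rfloor> = k"
proof -
  have "0 < (2::real) powi n"
    by simp
  then show ?thesis
    by (simp add: dyadic_interval_def floor_eq_iff field_simps)
qed

lemma dyadic_interval_children:
  "dyadic_interval n k = dyadic_interval (n - 1) (2 * k) \<union> dyadic_interval (n - 1) (2 * k + 1)"
  "dyadic_interval (n - 1) (2 * k) \<inter> dyadic_interval (n - 1) (2 * k + 1) = {}"
proof -
  show "dyadic_interval n k = dyadic_interval (n - 1) (2 * k) \<union> dyadic_interval (n - 1) (2 * k + 1)"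
    unfolding lower_half_dyadic[symmetric] upper_half_dyadic[symmetric]
    by (auto simp: lower_half_def upper_half_def)
qed (auto simp: mem_dyadic_interval_iff)

lemma dyadic_interval_lmeasurable: "dyadic_interval n k \<in> lmeasurable"
  unfolding dyadic_interval_def by (intro bounded_set_imp_lmeasurable) auto

lemma measure_dyadic_interval: "measure lebesgue (dyadic_interval n k) = 2 powi n"
  by (simp add: dyadic_interval_def algebra_simps)

text \<open>Local integrability speaks of compact sets only; the truncations to
  \<open>{- real i..real i}\<close> are measurable and eventually equal to \<open>f\<close> at each
  point.\<close>

lemma locally_integrable_borel_measurable:
  assumes "locally_integrable f"
  shows "f \<in> borel_measurable lebesgue"
proof (rule borel_measurable_LIMSEQ_real)
  fix i :: nat
  have "set_integrable lebesgue {- real i..real i} f"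
    using assms by (simp add: locally_integrable_def)
  then show "(\<lambda>x. indicator {- real i..real i} x *\<^sub>R f x) \<in> borel_measurable lebesgue"
    unfolding set_integrable_def by (rule borel_measurable_integrable)
next
  fix x :: real
  have "eventually (\<lambda>i. indicator {- real i..real i} x *\<^sub>R f x = f x) sequentially"
    using eventually_ge_at_top[of "nat \<lceil>\<bar>x\<bar>\<rceil>"]
  proof eventually_elim
    case (elim i)
    then have "\<bar>x\<bar> \<le> real i"
      by linarith
    then show ?case
      by (simp add: abs_le_iff minus_le_iff)
  qed
  then show "(\<lambda>i. indicator {- real i..real i} x *\<^sub>R f x) \<longlonglongrightarrow> f x"
    by (rule tendsto_eventually)
qed

lemma locally_integrable_restrict:
  assumes "locally_integrable f" "E \<in> sets lebesgue"
  shows "locally_integrable (\<lambda>x. indicator E x * f x)"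
  unfolding locally_integrable_def
proof (intro allI impI)
  fix K :: "real set"
  assume "compact K"
  then have "integrable lebesgue (\<lambda>x. indicator E x *\<^sub>R (indicator K x *\<^sub>R f x))"
    using assms(1) by (intro integrable_mult_indicator[OF assms(2)])
      (simp only: locally_integrable_def set_integrable_def)
  then show "(\<lambda>x. indicator E x * f x) absolutely_integrable_on K"
    by (simp add: set_integrable_def mult.left_commute)
qed

lemma set_integrable_dyadic_interval:
  assumes "locally_integrable f"
  shows "set_integrable lebesgue (dyadic_interval n k) f"
proof (rule set_integrable_subset)
  show "set_integrable lebesgue {of_int k * 2 powi n..(of_int k + 1) * 2 powi n} f"
    using assms by (simp add: locally_integrable_def)
  show "dyadic_interval n k \<in> sets lebesgue"
    using dyadic_interval_lmeasurable by auto
qed (auto simp: dyadic_interval_def)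

lemma set_integral_dyadic_interval:
  "(LINT x:dyadic_interval n k|lebesgue. f x) = 2 powi n * average f (dyadic_interval n k)"
  by (simp add: average_def measure_dyadic_interval)

lemma average_dyadic_children:
  assumes "locally_integrable f"
  shows "average f (dyadic_interval n k)
    = (average f (dyadic_interval (n - 1) (2 * k)) + average f (dyadic_interval (n - 1) (2 * k + 1))) / 2"
proof -
  define \<rho> :: real where "\<rho> = 2 powi (n - 1)"
  have \<rho>: "2 powi n = 2 * \<rho>" "0 < \<rho>"
    unfolding \<rho>_def using powi_split[of n] by simp_all
  have "(LINT x:dyadic_interval n k|lebesgue. f x)
      = (LINT x:dyadic_interval (n - 1) (2 * k)|lebesgue. f x)
      + (LINT x:dyadic_interval (n - 1) (2 * k + 1)|lebesgue. f x)"
    unfolding dyadic_interval_children(1)[of n k]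
    by (intro set_integral_Un dyadic_interval_children set_integrable_dyadic_interval assms)
  then have "\<rho> * (2 * average f (dyadic_interval n k)) = \<rho> * (average f (dyadic_interval (n - 1) (2 * k))
      + average f (dyadic_interval (n - 1) (2 * k + 1)))"
    unfolding set_integral_dyadic_interval \<rho>_def[symmetric] \<rho>(1)
    by (simp only: distrib_left mult_ac)
  then show ?thesis
    using \<rho>(2) by simp
qed

lemma average_nonneg:
  assumes "AE x in lebesgue. 0 \<le> f x"
  shows "0 \<le> average f J"
proof -
  have "0 \<le> (LINT x:J|lebesgue. f x)"
    unfolding set_lebesgue_integral_def
    using assms by (intro integral_nonneg_AE) (auto simp: indicator_def)
  then show ?thesis
    by (simp add: average_def)
qed

lemma average_dyadic_mono:
  assumes "locally_integrable f" "locally_integrable g" "AE x in lebesgue. f x \<le> g x"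
  shows "average f (dyadic_interval n k) \<le> average g (dyadic_interval n k)"
proof -
  have "(LINT x:dyadic_interval n k|lebesgue. f x) \<le> (LINT x:dyadic_interval n k|lebesgue. g x)"
    unfolding set_lebesgue_integral_def
    using assms set_integrable_dyadic_interval
    by (intro integral_mono_AE) (auto simp: set_integrable_def indicator_def)
  then show ?thesis
    unfolding average_def by (simp add: divide_right_mono)
qed

lemma emeasure_density_dyadic_interval:
  assumes "locally_integrable f" "AE x in lebesgue. 0 \<le> f x"
  shows "emeasure (density lebesgue (\<lambda>x. ennreal (f x))) (dyadic_interval n k)
    = ennreal (2 powi n * average f (dyadic_interval n k))"
proof -
  have "emeasure (density lebesgue (\<lambda>x. ennreal (f x))) (dyadic_interval n k)
      = (\<integral>\<^sup>+x. ennreal (f x) * indicator (dyadic_interval n k) x \<partial>lebesgue)"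
    using locally_integrable_borel_measurable[OF assms(1)] dyadic_interval_lmeasurable
    by (intro emeasure_density) auto
  also have "\<dots> = (\<integral>\<^sup>+x. ennreal (indicator (dyadic_interval n k) x *\<^sub>R f x) \<partial>lebesgue)"
    by (intro nn_integral_cong) (simp add: indicator_def)
  also have "\<dots> = ennreal (LINT x:dyadic_interval n k|lebesgue. f x)"
    unfolding set_lebesgue_integral_def
    using assms set_integrable_dyadic_interval[OF assms(1), of n k]
    by (intro nn_integral_eq_integral) (auto simp: set_integrable_def indicator_def)
  finally show ?thesis
    by (simp add: set_integral_dyadic_interval)
qed

text \<open>The martingale difference takes opposite values on the two halves, so its square is
  constant on the interval.\<close>

lemma mart_diff_dyadic_sq:
  assumes "x \<in> dyadic_interval n k"
  shows "(mart_diff (dyadic_interval n k) f x)\<^sup>2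
    = ((average f (dyadic_interval (n - 1) (2 * k + 1)) - average f (dyadic_interval (n - 1) (2 * k))) / 2)\<^sup>2"
proof (cases "x \<in> dyadic_interval (n - 1) (2 * k)")
  case True
  then have "x \<notin> dyadic_interval (n - 1) (2 * k + 1)"
    using dyadic_interval_children(2)[of n k] by auto
  with True show ?thesis
    unfolding mart_diff_def lower_half_dyadic upper_half_dyadic
    by (simp add: power2_eq_square algebra_simps)
next
  case False
  then have "x \<in> dyadic_interval (n - 1) (2 * k + 1)"
    using assms dyadic_interval_children(1)[of n k] by auto
  with False show ?thesis
    unfolding mart_diff_def lower_half_dyadic upper_half_dyadic by simp
qed

section \<open>Reduction of the square function to finite sums\<close>

lemma ennsqrt_ennreal: "0 \<le> r \<Longrightarrow> ennsqrt (ennreal r) = ennreal (sqrt r)"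
  by (simp add: ennsqrt_def)

text \<open>A sum in \<open>ennreal\<close> is the supremum of its finite subsums, finitely many
  intervals occupy finitely many levels, and at each level only one interval contains
  \<open>x\<close>.\<close>

lemma less_square_funD:
  assumes "ennreal t < square_fun f x" "0 \<le> t"
  obtains N :: nat where
    "t\<^sup>2 < (\<Sum>n\<in>{- int N..int N}. (mart_diff (dyadic_interval n \<lfloor>x / 2 powi n\<rfloor>) f x)\<^sup>2)"
proof -
  define h where "h J = \<bar>mart_diff J f x\<bar>\<^sup>2 * indicator J x" for J
  define a where "a = (\<Sum>\<^sub>\<infinity>J\<in>dyadic_intervals. ennreal (h J))"
  have less: "ennreal t < ennsqrt a"
    using assms(1) by (simp add: square_fun_def a_def h_def)
  have "ennreal (t\<^sup>2) < a"
  proof (cases a)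
    case (real r)
    then have "t < sqrt r"
      using less assms(2) by (simp add: ennsqrt_ennreal ennreal_less_iff)
    then have "t\<^sup>2 < (sqrt r)\<^sup>2"
      using assms(2) by (intro power_strict_mono) auto
    then have "t\<^sup>2 < r"
      using real by simp
    then show ?thesis
      using real assms(2) by (simp add: ennreal_less_iff)
  qed simp
  also have "a = (SUP F\<in>{F. finite F \<and> F \<subseteq> dyadic_intervals}. \<Sum>J\<in>F. ennreal (h J))"
    unfolding a_def by (intro nonneg_infsum_complete) simp
  finally obtain F where F: "finite F" "F \<subseteq> dyadic_intervals"
    and "ennreal (t\<^sup>2) < (\<Sum>J\<in>F. ennreal (h J))"
    by (auto simp: less_SUP_iff)
  then have t: "t\<^sup>2 < (\<Sum>J\<in>F. h J)"
    by (simp add: sum_ennreal h_def ennreal_less_iff sum_nonneg)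
  have "\<forall>J\<in>F. \<exists>n k. J = dyadic_interval n k"
    using F by (auto simp: dyadic_intervals_def)
  then obtain lev where lev: "\<And>J. J \<in> F \<Longrightarrow> \<exists>k. J = dyadic_interval (lev J) k"
    by metis
  \<comment> \<open>The sum of the absolute levels is a common bound that also covers empty
    \<open>F\<close>.\<close>
  define N where "N = (\<Sum>J\<in>F. nat \<bar>lev J\<bar>)"
  have N: "lev J \<in> {- int N..int N}" if "J \<in> F" for J
  proof -
    have "nat \<bar>lev J\<bar> \<le> N"
      unfolding N_def using F that by (intro member_le_sum) auto
    then show ?thesis
      by auto
  qed
  let ?I = "\<lambda>n. dyadic_interval n \<lfloor>x / 2 powi n\<rfloor>"
  have "(\<Sum>J\<in>F. h J) = (\<Sum>J\<in>{J\<in>F. x \<in> J}. h J)"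
    using F by (intro sum.mono_neutral_right) (auto simp: h_def)
  also have "\<dots> \<le> (\<Sum>J\<in>?I ` {- int N..int N}. h J)"
  proof (rule sum_mono2)
    show "{J\<in>F. x \<in> J} \<subseteq> ?I ` {- int N..int N}"
    proof
      fix J
      assume "J \<in> {J\<in>F. x \<in> J}"
      then have J: "J \<in> F" "x \<in> J"
        by auto
      obtain k where k: "J = dyadic_interval (lev J) k"
        using lev[OF J(1)] by blast
      then have "\<lfloor>x / 2 powi (lev J)\<rfloor> = k"
        using J(2) mem_dyadic_interval_iff by metis
      then have "J = ?I (lev J)"
        using k by simp
      then show "J \<in> ?I ` {- int N..int N}"
        using N[OF J(1)] by blast
    qed
  qed (auto simp: h_def)
  also have "\<dots> \<le> (\<Sum>n\<in>{- int N..int N}. h (?I n))"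
    using sum_image_le[of "{- int N..int N}" h ?I] by (simp add: h_def comp_def)
  also have "\<dots> = (\<Sum>n\<in>{- int N..int N}. (mart_diff (?I n) f x)\<^sup>2)"
    by (intro sum.cong) (auto simp: h_def mem_dyadic_interval_iff)
  finally show thesis
    by (intro that[of N] less_le_trans[OF t])
qed

section \<open>The weak-type bound for nonnegative dyadic martingales\<close>

text \<open>\<open>p n k\<close> will be the average of the function over
  \<open>dyadic_interval n k\<close>, divided by the threshold.\<close>

locale dyadic_martingale =
  fixes p :: "int \<Rightarrow> int \<Rightarrow> real"
  assumes mart: "p n k = (p (n - 1) (2 * k) + p (n - 1) (2 * k + 1)) / 2"
    and nonneg: "0 \<le> p n k"
begin

definition diff2 :: "int \<Rightarrow> int \<Rightarrow> real" where
  "diff2 n k = ((p (n - 1) (2 * k + 1) - p (n - 1) (2 * k)) / 2)\<^sup>2"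

text \<open>The contribution of the levels from \<open>n\<close> down to \<open>n - d + 1\<close> to
  the square of the square function. Counting from the top lets induction on \<open>d\<close> peel
  off the largest interval.\<close>

definition square_sum :: "int \<Rightarrow> nat \<Rightarrow> real \<Rightarrow> real" where
  "square_sum n d x = (\<Sum>i<d. diff2 (n - int i) \<lfloor>x / 2 powi (n - int i)\<rfloor>)"

lemma diff2_nonneg: "0 \<le> diff2 n k"
  by (simp add: diff2_def)

lemma square_sum_Suc:
  assumes "x \<in> dyadic_interval n k"
  shows "square_sum n (Suc d) x = diff2 n k + square_sum (n - 1) d x"
proof -
  have "\<lfloor>x / 2 powi n\<rfloor> = k"
    using assms by (simp add: mem_dyadic_interval_iff)
  then show ?thesis
    unfolding square_sum_def sum.lessThan_Suc_shift by (simp add: algebra_simps)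
qed

lemma square_sum_symmetric:
  "square_sum (int N) (2 * N + 1) x = (\<Sum>n\<in>{- int N..int N}. diff2 n \<lfloor>x / 2 powi n\<rfloor>)"
  unfolding square_sum_def
  by (rule sum.reindex_bij_witness[of _ "\<lambda>n. nat (int N - n)" "\<lambda>i. int N - int i"]) auto

lemma borel_measurable_square_sum [measurable]: "square_sum n d \<in> borel_measurable borel"
  unfolding square_sum_def by measurable

lemma superlevel_square_sum_sets:
  "{x \<in> dyadic_interval n k. c < s + square_sum j d x} \<in> sets lebesgue"
proof -
  have "{x \<in> space borel. c < s + square_sum j d x} \<in> sets borel"
    by measurable
  then have "{x. c < s + square_sum j d x} \<in> sets lebesgue"
    by (simp add: sets_completionI_sets)
  then have "dyadic_interval n k \<inter> {x. c < s + square_sum j d x} \<in> sets lebesgue"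
    using dyadic_interval_lmeasurable by (intro sets.Int) auto
  then show ?thesis
    by (simp add: Collect_conj_eq Int_commute)
qed

text \<open>Chebyshev for \<open>(s + square_sum n d x)^2\<close>, a fourth power of the square
  function. The term with \<open>s^2\<close> is what has already accumulated; the Bellman term pays
  for later growth and for stopped intervals. The bound 2 on the average admits the children of an
  interval that was not stopped.\<close>

lemma weak_type_dyadic_interval:
  assumes sets: "sets M = sets lebesgue"
    and m: "\<And>n k. emeasure M (dyadic_interval n k) = ennreal (m n k)" "\<And>n k. 0 \<le> m n k"
    and K: "\<And>n k. m n k * p n k \<le> K * 2 powi n"
    and "p n k \<le> 2" "0 \<le> s"
  shows "emeasure M {x \<in> dyadic_interval n k. 1 < s + square_sum n d x}
    \<le> ennreal (m n k * s\<^sup>2 + K * 2 powi n * bellman (p n k) s)"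
  using assms(5,6)
proof (induction d arbitrary: n k s)
  case 0
  have "p n k \<le> bellman (p n k) s"
    using 0 nonneg by (intro bellman_ge)
  then have B: "0 \<le> bellman (p n k) s"
    using nonneg[of n k] by simp
  have "0 \<le> m n k * p n k"
    using m nonneg by simp
  then have "0 \<le> K * 2 powi n"
    using K[of n k] by linarith
  then have KB: "0 \<le> K * 2 powi n * bellman (p n k) s"
    using B by simp
  \<comment> \<open>No level remains, so the set is the whole interval or empty; in the first case
    \<open>s^2\<close> exceeds 1.\<close>
  show ?case
  proof (cases "1 < s")
    case True
    then have "m n k * 1 \<le> m n k * s\<^sup>2"
      using m by (intro mult_left_mono) auto
    then have "m n k \<le> m n k * s\<^sup>2 + K * 2 powi n * bellman (p n k) s"
      using KB by simp
    then show ?thesis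
      using True by (simp add: square_sum_def m ennreal_leI del: ennreal_plus)
  qed (simp add: square_sum_def)
next
  case (Suc d)
  have "p n k \<le> bellman (p n k) s"
    using Suc.prems nonneg by (intro bellman_ge)
  then have B: "0 \<le> bellman (p n k) s" "p n k \<le> bellman (p n k) s"
    using nonneg[of n k] by auto
  have "0 \<le> m n k * p n k"
    using m nonneg by simp
  then have K0: "0 \<le> K * 2 powi n"
    using K[of n k] by linarith
  have J: "dyadic_interval n k \<in> sets M" for n k
    using dyadic_interval_lmeasurable by (auto simp: sets)
  let ?S = "{x \<in> dyadic_interval n k. 1 < s + square_sum n (Suc d) x}"
  show ?case
  proof (cases "1 < p n k")
    case True
    \<comment> \<open>Stopping: the average exceeds 1, so the mass of the whole interval is at most
      \<open>K * 2 powi n\<close> and all of it is given away.\<close>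
    have "m n k * 1 \<le> m n k * p n k"
      using True m by (intro mult_left_mono) auto
    also have "\<dots> \<le> K * 2 powi n"
      by (rule K)
    also have "\<dots> = K * 2 powi n * 1"
      by simp
    also have "\<dots> \<le> K * 2 powi n * bellman (p n k) s"
      using True B K0 by (intro mult_left_mono) auto
    also have "\<dots> \<le> m n k * s\<^sup>2 + K * 2 powi n * bellman (p n k) s"
      using m by simp
    finally have le: "m n k \<le> m n k * s\<^sup>2 + K * 2 powi n * bellman (p n k) s"
      by simp
    have "emeasure M ?S \<le> emeasure M (dyadic_interval n k)"
      using J by (intro emeasure_mono) auto
    also have "\<dots> \<le> ennreal (m n k * s\<^sup>2 + K * 2 powi n * bellman (p n k) s)"
      unfolding m using le by (rule ennreal_leI)
    finally show ?thesis .
  next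
    case False
    define a where "a = p (n - 1) (2 * k)"
    define b where "b = p (n - 1) (2 * k + 1)"
    define \<delta> where "\<delta> = diff2 n k"
    have ab: "0 \<le> a" "0 \<le> b" "p n k = (a + b) / 2"
      using nonneg mart[of n k] by (auto simp: a_def b_def)
    have \<delta>: "0 \<le> \<delta>" "\<delta> = ((b - a) / 2)\<^sup>2"
      by (auto simp: \<delta>_def diff2_def a_def b_def)
    let ?T = "\<lambda>j. {x \<in> dyadic_interval (n - 1) j. 1 < (s + \<delta>) + square_sum (n - 1) d x}"
    have T: "?T j \<in> sets M" for j
      unfolding sets by (rule superlevel_square_sum_sets)
    \<comment> \<open>The top increment is constant on the interval, so it moves into the
      accumulated sum handed to both children.\<close>
    have S_eq: "?S = ?T (2 * k) \<union> ?T (2 * k + 1)"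
      using square_sum_Suc[of _ n k d] dyadic_interval_children(1)[of n k]
      by (auto simp: \<delta>_def add.assoc)
    have "emeasure M (dyadic_interval n k)
        = emeasure M (dyadic_interval (n - 1) (2 * k)) + emeasure M (dyadic_interval (n - 1) (2 * k + 1))"
      by (subst plus_emeasure) (use J dyadic_interval_children[of n k] in auto)
    then have m_add: "m n k = m (n - 1) (2 * k) + m (n - 1) (2 * k + 1)"
      unfolding m using m(2) by (simp flip: ennreal_plus)
    define \<rho> :: real where "\<rho> = 2 powi (n - 1)"
    have half: "2 powi n = 2 * \<rho>"
      unfolding \<rho>_def by (rule powi_split)
    \<comment> \<open>The bound on \<open>m n k * p n k\<close> trades mass for length and turns the
      growth of \<open>m n k * s^2\<close> into the extra term of
      \<open>bellman_step\<close>.\<close>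
    have main: "m n k * (2 * s * \<delta> + \<delta>\<^sup>2) + K * 2 powi n * ((bellman a (s + \<delta>) + bellman b (s + \<delta>)) / 2)
        \<le> K * 2 powi n * bellman (p n k) s"
    proof (cases "p n k = 0")
      \<comment> \<open>\<open>bellman_step\<close> divides by the average. If it is 0, both
        children and \<open>\<delta>\<close> vanish, and both sides are 0.\<close>
      case True
      then have "a = 0" "b = 0"
        using ab by auto
      then show ?thesis
        using True \<delta> by (simp add: bellman_def)
    next
      case p: False
      then have p0: "0 < p n k"
        using nonneg[of n k] by simp
      have c: "0 \<le> 2 * s * \<delta> + \<delta>\<^sup>2"
        using \<delta> Suc.prems by simp
      have "m n k * p n k * ((2 * s * \<delta> + \<delta>\<^sup>2) / p n k) \<le> K * 2 powi n * ((2 * s * \<delta> + \<delta>\<^sup>2) / p n k)"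
        using c p0 K by (intro mult_right_mono) auto
      then have "m n k * (2 * s * \<delta> + \<delta>\<^sup>2) \<le> K * 2 powi n * ((2 * s * \<delta> + \<delta>\<^sup>2) / p n k)"
        using p by simp
      moreover have "K * 2 powi n * ((bellman a (s + \<delta>) + bellman b (s + \<delta>)) / 2 + (2 * s * \<delta> + \<delta>\<^sup>2) / p n k)
          \<le> K * 2 powi n * bellman (p n k) s"
        using ab p0 False \<delta> Suc.prems K0 by (intro mult_left_mono bellman_step) auto
      ultimately show ?thesis
        by (simp add: distrib_left)
    qed
    let ?U = "\<lambda>j. m (n - 1) j * (s + \<delta>)\<^sup>2 + K * \<rho> * bellman (p (n - 1) j) (s + \<delta>)"
    \<comment> \<open>Two nonnegative numbers with mean at most 1 are each at most 2.\<close>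
    have child: "p (n - 1) j \<le> 2" "0 \<le> s + \<delta>" if "j = 2 * k \<or> j = 2 * k + 1" for j
      using that ab False \<delta> Suc.prems by (auto simp: a_def b_def)
    have U0: "0 \<le> ?U j" if "j = 2 * k \<or> j = 2 * k + 1" for j
    proof -
      have "p (n - 1) j \<le> bellman (p (n - 1) j) (s + \<delta>)"
        using nonneg child[OF that] by (intro bellman_ge) auto
      then have "0 \<le> bellman (p (n - 1) j) (s + \<delta>)"
        using nonneg[of "n - 1" j] by simp
      moreover have "0 \<le> K * \<rho>"
        using K0 by (simp add: half)
      ultimately show ?thesis
        using m by simp
    qed
    have "emeasure M ?S \<le> emeasure M (?T (2 * k)) + emeasure M (?T (2 * k + 1))"
      unfolding S_eq using T by (intro emeasure_subadditive)
    also have "\<dots> \<le> ennreal (?U (2 * k)) + ennreal (?U (2 * k + 1))"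
      unfolding \<rho>_def using child by (intro add_mono Suc.IH) auto
    also have "\<dots> = ennreal (?U (2 * k) + ?U (2 * k + 1))"
      using U0 by (intro ennreal_plus[symmetric]) auto
    also have "\<dots> \<le> ennreal (m n k * s\<^sup>2 + K * 2 powi n * bellman (p n k) s)"
    proof (rule ennreal_leI)
      have "?U (2 * k) + ?U (2 * k + 1)
          = m n k * s\<^sup>2 + (m n k * (2 * s * \<delta> + \<delta>\<^sup>2)
            + K * 2 powi n * ((bellman a (s + \<delta>) + bellman b (s + \<delta>)) / 2))"
        by (simp add: m_add half a_def b_def power2_eq_square algebra_simps)
      also have "\<dots> \<le> m n k * s\<^sup>2 + K * 2 powi n * bellman (p n k) s"
        using main by simp
      finally show "?U (2 * k) + ?U (2 * k + 1) \<le> m n k * s\<^sup>2 + K * 2 powi n * bellman (p n k) s" .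
    qed
    finally show ?thesis .
  qed
qed

text \<open>Every interval of level \<open>n\<close> starts with \<open>s = 0\<close>, where the
  Bellman function is at most \<open>35 * p n k\<close>. Summing over the level gives the total mass
  of \<open>N\<close>, the measure whose averages are \<open>p\<close>.\<close>

lemma weak_type_level:
  assumes sets: "sets M = sets lebesgue" "sets N = sets lebesgue"
    and m: "\<And>n k. emeasure M (dyadic_interval n k) = ennreal (m n k)" "\<And>n k. 0 \<le> m n k"
    and K: "\<And>n k. m n k * p n k \<le> K * 2 powi n" "0 \<le> K"
    and N: "\<And>n k. emeasure N (dyadic_interval n k) = ennreal (2 powi n * p n k)"
    and p: "\<And>k. p n k \<le> 2"
  shows "emeasure M {x. 1 < square_sum n d x} \<le> ennreal (35 * K) * emeasure N UNIV"
proof -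
  let ?S = "\<lambda>k. {x \<in> dyadic_interval n k. 1 < square_sum n d x}"
  have J: "dyadic_interval n k \<in> sets lebesgue" for n k
    using dyadic_interval_lmeasurable by auto
  have S: "?S k \<in> sets lebesgue" for k
    using superlevel_square_sum_sets[of n k 1 0 n d] by simp
  have bound: "emeasure M (?S k) \<le> ennreal (35 * K) * emeasure N (dyadic_interval n k)" for k
  proof -
    have "emeasure M (?S k) \<le> ennreal (m n k * 0\<^sup>2 + K * 2 powi n * bellman (p n k) 0)"
      using weak_type_dyadic_interval[OF sets(1) m K(1) p, of 0 k d] by simp
    also have "\<dots> \<le> ennreal (35 * K * (2 powi n * p n k))"
    proof (rule ennreal_leI)
      have "K * 2 powi n * bellman (p n k) 0 \<le> K * 2 powi n * (35 * p n k)"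
        using K(2) by (intro mult_left_mono) (auto simp: bellman_def)
      then show "m n k * 0\<^sup>2 + K * 2 powi n * bellman (p n k) 0 \<le> 35 * K * (2 powi n * p n k)"
        by (simp add: algebra_simps)
    qed
    also have "\<dots> = ennreal (35 * K) * emeasure N (dyadic_interval n k)"
      using K(2) nonneg by (simp add: N ennreal_mult)
    finally show ?thesis .
  qed
  have disj: "disjoint_family (\<lambda>k. dyadic_interval n k)" "disjoint_family ?S"
    by (auto simp: disjoint_family_on_def mem_dyadic_interval_iff)
  have "{x. 1 < square_sum n d x} = (\<Union>k. ?S k)"
    by (auto simp: mem_dyadic_interval_iff)
  then have "emeasure M {x. 1 < square_sum n d x} = (\<integral>\<^sup>+k. emeasure M (?S k) \<partial>count_space UNIV)"
    using S disj sets by (simp add: emeasure_UN_countable)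
  also have "\<dots> \<le> (\<integral>\<^sup>+k. ennreal (35 * K) * emeasure N (dyadic_interval n k) \<partial>count_space UNIV)"
    by (intro nn_integral_mono bound)
  also have "\<dots> = ennreal (35 * K) * (\<integral>\<^sup>+k. emeasure N (dyadic_interval n k) \<partial>count_space UNIV)"
    by (simp add: nn_integral_cmult)
  also have "(\<integral>\<^sup>+k. emeasure N (dyadic_interval n k) \<partial>count_space UNIV)
      = emeasure N (\<Union>k. dyadic_interval n k)"
    using J disj sets by (simp add: emeasure_UN_countable)
  also have "(\<Union>k. dyadic_interval n k) = UNIV"
    by (auto simp: mem_dyadic_interval_iff)
  finally show ?thesis .
qed

end

section \<open>The estimate for weights\<close>

text \<open>Dividing the function by \<open>t\<close> makes the threshold 1. One factor
  \<open>1 / t\<close> then comes from the constant \<open>K = Q / t\<close>, the other from the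
  total mass \<open>v / t\<close>.\<close>

lemma weight_measure_superlevel_le:
  assumes w: "dyadic_A2 w" and E: "E \<in> sets lebesgue" and t: "0 < t"
    and v: "weight_measure (\<lambda>x. inverse (w x)) E = ennreal v" "0 \<le> v"
    and Q: "A2_const w = ennreal Q" "0 \<le> Q"
  shows "weight_measure w {x. weighted_square_fun (\<lambda>y. inverse (w y)) (indicator E) x > ennreal t}
    \<le> ennreal (35 * Q * v / t\<^sup>2)"
proof -
  define \<sigma> where "\<sigma> x = inverse (w x)" for x
  define f where "f x = indicator E x * \<sigma> x" for x
  define p where "p n k = average f (dyadic_interval n k) / t" for n k
  define M where "M = density lebesgue (\<lambda>x. ennreal (w x))"
  define N where "N = density lebesgue (\<lambda>x. ennreal (f x / t))"
  define m where "m n k = 2 powi n * average w (dyadic_interval n k)" for n k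
  have AE_w: "AE x in lebesgue. 0 < w x" and int_w: "locally_integrable w" and int_\<sigma>: "locally_integrable \<sigma>"
    using w by (auto simp: dyadic_A2_def weight_def \<sigma>_def[abs_def])
  have int_f: "locally_integrable f"
    unfolding f_def[abs_def] using int_\<sigma> E by (rule locally_integrable_restrict)
  have w_nonneg: "AE x in lebesgue. 0 \<le> w x"
    using AE_w by eventually_elim simp
  have f_nonneg: "AE x in lebesgue. 0 \<le> f x"
    using AE_w by eventually_elim (simp add: f_def \<sigma>_def indicator_def)
  have f_le: "AE x in lebesgue. f x \<le> \<sigma> x"
    using AE_w by eventually_elim (simp add: f_def \<sigma>_def indicator_def)
  interpret dyadic_martingale p
  proof
    fix n k
    show "p n k = (p (n - 1) (2 * k) + p (n - 1) (2 * k + 1)) / 2"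
      unfolding p_def average_dyadic_children[OF int_f, of n k] by (simp add: add_divide_distrib)
    show "0 \<le> p n k"
      unfolding p_def using average_nonneg[OF f_nonneg] t by simp
  qed
  have sets_M: "sets M = sets lebesgue" and sets_N: "sets N = sets lebesgue"
    by (simp_all add: M_def N_def)
  have em_M: "emeasure M (dyadic_interval n k) = ennreal (m n k)" for n k
    unfolding M_def m_def using int_w w_nonneg by (rule emeasure_density_dyadic_interval)
  have m_nonneg: "0 \<le> m n k" for n k
    unfolding m_def using average_nonneg[OF w_nonneg] by simp
  have mp: "m n k * p n k \<le> Q / t * 2 powi n" for n k
  proof -
    let ?J = "dyadic_interval n k"
    have "average w ?J * average f ?J \<le> average w ?J * average \<sigma> ?J"
      using average_dyadic_mono[OF int_f int_\<sigma> f_le] average_nonneg[OF w_nonneg]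
      by (intro mult_left_mono) auto
    also have "\<dots> \<le> Q"
    proof -
      have "?J \<in> dyadic_intervals"
        by (auto simp: dyadic_intervals_def)
      then have "ennreal (average w ?J * average \<sigma> ?J) \<le> A2_const w"
        unfolding A2_const_def \<sigma>_def[abs_def] by (rule SUP_upper)
      then show ?thesis
        using Q by (simp add: ennreal_le_iff)
    qed
    finally have "average w ?J * average f ?J * (2 powi n / t) \<le> Q * (2 powi n / t)"
      using t by (intro mult_right_mono) auto
    then show ?thesis
      by (simp add: m_def p_def mult_ac)
  qed
  have em_N: "emeasure N (dyadic_interval n k) = ennreal (2 powi n * p n k)" for n k
  proof -
    have "locally_integrable (\<lambda>x. f x / t)"
      using int_f by (simp add: locally_integrable_def set_integrable_divide)
    moreover have "AE x in lebesgue. 0 \<le> f x / t"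
      using f_nonneg by eventually_elim (use t in simp)
    moreover have "average (\<lambda>x. f x / t) (dyadic_interval n k) = p n k"
      by (simp add: average_def p_def)
    ultimately show ?thesis
      unfolding N_def by (simp add: emeasure_density_dyadic_interval)
  qed
  have N_UNIV: "emeasure N UNIV = ennreal (v / t)"
  proof -
    have meas: "f \<in> borel_measurable lebesgue" "\<sigma> \<in> borel_measurable lebesgue"
      using int_f int_\<sigma> by (auto intro: locally_integrable_borel_measurable)
    have "emeasure N UNIV = (\<integral>\<^sup>+x. ennreal (f x / t) \<partial>lebesgue)"
      unfolding N_def using meas by (subst emeasure_density) auto
    also have "\<dots> = (\<integral>\<^sup>+x. ennreal (1 / t) * (ennreal (\<sigma> x) * indicator E x) \<partial>lebesgue)"
      using t by (intro nn_integral_cong) (simp add: f_def indicator_def flip: ennreal_mult')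
    also have "\<dots> = ennreal (1 / t) * weight_measure \<sigma> E"
      unfolding weight_measure_def using meas E by (intro nn_integral_cmult) auto
    also have "\<dots> = ennreal (v / t)"
      using v t by (simp add: \<sigma>_def[abs_def] flip: ennreal_mult')
    finally show ?thesis .
  qed
  let ?C = "ennreal (35 * Q * v / t\<^sup>2)"
  define A where "A i = {x. 1 < square_sum (int i) (2 * i + 1) x}" for i
  have A_sets: "A i \<in> sets M" for i
  proof -
    have "{x \<in> space borel. 1 < square_sum (int i) (2 * i + 1) x} \<in> sets borel"
      by measurable
    then show ?thesis
      by (simp add: A_def sets_M sets_completionI_sets)
  qed
  have A_mono: "incseq A"
  proof (rule incseq_SucI)
    fix i
    have "square_sum (int i) (2 * i + 1) x \<le> square_sum (int (Suc i)) (2 * Suc i + 1) x" for x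
      unfolding square_sum_symmetric by (intro sum_mono2) (auto simp: diff2_nonneg)
    then show "A i \<subseteq> A (Suc i)"
      unfolding A_def by (fastforce intro: less_le_trans)
  qed
  \<comment> \<open>The total mass is finite, so no average exceeds 1 from level \<open>i0\<close>
    upwards, and the descent can start there.\<close>
  obtain i0 where i0: "v / t < 2 ^ i0"
    using real_arch_pow[of 2 "v / t"] by auto
  have A_le: "emeasure M (A i) \<le> ?C" for i
  proof -
    \<comment> \<open>The sets \<open>A i\<close> increase, so it suffices to bound one with a large
      enough index.\<close>
    define j where "j = max i i0"
    have "p (int j) k \<le> 1" for k
    proof -
      have "emeasure N (dyadic_interval (int j) k) \<le> emeasure N UNIV"
        by (intro emeasure_mono) (auto simp: sets_N)
      then have "2 ^ j * p (int j) k \<le> v / t"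
        using v t by (simp add: em_N N_UNIV ennreal_le_iff)
      also have "\<dots> \<le> 2 ^ i0"
        using i0 by simp
      also have "\<dots> \<le> 2 ^ j * 1"
        by (simp add: j_def)
      finally show ?thesis
        by (subst (asm) mult_le_cancel_left_pos) auto
    qed
    then have p2: "p (int j) k \<le> 2" for k
      by (rule order_trans) simp
    have "emeasure M (A i) \<le> emeasure M (A j)"
      using A_sets A_mono by (intro emeasure_mono) (auto simp: j_def incseq_def)
    also have "\<dots> \<le> ennreal (35 * (Q / t)) * emeasure N UNIV"
      unfolding A_def using t Q
      by (intro weak_type_level[OF sets_M sets_N em_M m_nonneg mp _ em_N p2]) simp
    also have "\<dots> = ?C"
      using Q v t by (simp add: N_UNIV power2_eq_square flip: ennreal_mult)
    finally show ?thesis .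
  qed
  let ?S = "{x. weighted_square_fun (\<lambda>y. inverse (w y)) (indicator E) x > ennreal t}"
  have S_sub: "?S \<subseteq> (\<Union>i. A i)"
  proof
    fix x
    assume "x \<in> ?S"
    then have "ennreal t < square_fun f x"
      by (simp add: weighted_square_fun_def f_def[abs_def] \<sigma>_def)
    then obtain i :: nat
      where i: "t\<^sup>2 < (\<Sum>n\<in>{- int i..int i}. (mart_diff (dyadic_interval n \<lfloor>x / 2 powi n\<rfloor>) f x)\<^sup>2)"
      using t less_square_funD[of t f x] by auto
    \<comment> \<open>\<open>p\<close> carries the factor \<open>1 / t\<close>, so squared
      differences rescale by the square of \<open>t\<close>.\<close>
    have "(mart_diff (dyadic_interval n \<lfloor>x / 2 powi n\<rfloor>) f x)\<^sup>2 = t\<^sup>2 * diff2 n \<lfloor>x / 2 powi n\<rfloor>" for n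
    proof -
      have "x \<in> dyadic_interval n \<lfloor>x / 2 powi n\<rfloor>"
        by (simp add: mem_dyadic_interval_iff)
      then show ?thesis
        using t by (simp add: mart_diff_dyadic_sq diff2_def p_def power_divide flip: diff_divide_distrib)
    qed
    then have "t\<^sup>2 * 1 < t\<^sup>2 * square_sum (int i) (2 * i + 1) x"
      using i unfolding square_sum_symmetric by (simp add: sum_distrib_left)
    then have "x \<in> A i"
      using t by (simp add: A_def)
    then show "x \<in> (\<Union>i. A i)"
      by blast
  qed
  \<comment> \<open>\<open>weight_measure\<close> is a nonnegative integral, hence monotone for
    arbitrary sets; measurability is established for the sets \<open>A i\<close>.\<close>
  have "weight_measure w ?S \<le> weight_measure w (\<Union>i. A i)"
    unfolding weight_measure_def
    using S_sub by (intro nn_integral_mono) (auto simp: indicator_def)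
  also have "\<dots> = emeasure M (\<Union>i. A i)"
    unfolding weight_measure_def M_def
    using A_sets locally_integrable_borel_measurable[OF int_w]
    by (intro emeasure_density[symmetric]) (auto simp: sets_M)
  also have "\<dots> = (SUP i. emeasure M (A i))"
    using A_sets A_mono by (intro SUP_emeasure_incseq[symmetric]) auto
  also have "\<dots> \<le> ?C"
    using A_le by (intro SUP_least)
  finally show ?thesis .
qed

theorem theorem5p4:
  shows "\<exists>A::ennreal. A < \<infinity> \<and>
    (\<forall>w::real \<Rightarrow> real. dyadic_A2 w \<longrightarrow>
      (\<forall>E \<in> sets lebesgue. weight_measure (\<lambda>x. inverse (w x)) E < \<infinity> \<longrightarrow>
        (\<forall>t::real. 0 < t \<longrightarrow>
          ennreal t *
            ennsqrt (weight_measure w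
              {x. weighted_square_fun (\<lambda>y. inverse (w y)) (indicator E) x > ennreal t})
          \<le> A * ennsqrt (A2_const w) * ennsqrt (weight_measure (\<lambda>x. inverse (w x)) E))))"
proof (intro exI[of _ "ennreal (sqrt 35)"] conjI allI impI ballI)
  fix w :: "real \<Rightarrow> real" and E :: "real set" and t :: real
  assume w: "dyadic_A2 w" and E: "E \<in> sets lebesgue" and t: "0 < t"
    and fin: "weight_measure (\<lambda>x. inverse (w x)) E < \<infinity>"
  let ?W = "weight_measure w {x. weighted_square_fun (\<lambda>y. inverse (w y)) (indicator E) x > ennreal t}"
  obtain v where v: "weight_measure (\<lambda>x. inverse (w x)) E = ennreal v" "0 \<le> v"
    using fin by (cases "weight_measure (\<lambda>x. inverse (w x)) E") auto
  obtain Q where Q: "A2_const w = ennreal Q" "0 \<le> Q"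
    using w by (cases "A2_const w") (auto simp: dyadic_A2_def)
  have W: "?W \<le> ennreal (35 * Q * v / t\<^sup>2)"
    using w E t v Q by (rule weight_measure_superlevel_le)
  obtain r where r: "?W = ennreal r" "0 \<le> r"
    using W by (cases ?W) (auto simp: top_unique)
  have "r \<le> 35 * Q * v / t\<^sup>2"
    using W Q v by (simp add: r ennreal_le_iff)
  then have "t\<^sup>2 * r \<le> 35 * Q * v"
    using t by (simp add: pos_le_divide_eq mult.commute)
  \<comment> \<open>Roots of the distributional estimate give the constant \<open>sqrt 35\<close>
    and the power 1/2 of \<open>Q\<close>.\<close>
  then have "sqrt (t\<^sup>2 * r) \<le> sqrt (35 * Q * v)"
    by simp
  then have "t * sqrt r \<le> sqrt 35 * sqrt Q * sqrt v"
    using t by (simp add: real_sqrt_mult)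
  then show "ennreal t * ennsqrt ?W
      \<le> ennreal (sqrt 35) * ennsqrt (A2_const w) * ennsqrt (weight_measure (\<lambda>x. inverse (w x)) E)"
    unfolding r(1) v(1) Q(1) using r(2) v(2) Q(2) t
    by (simp add: ennsqrt_ennreal ennreal_leI flip: ennreal_mult)
qed simp

end
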